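(* Let $T\ge1$ be an integer and let $\lambda\in\mathbb{R}$ with $\lambda<\lambda_1$, where $\lambda_1=2-2\cos\left(\frac{\pi}{T+1}\right)$. Let $G(t,s)$ be the Green's function of the discrete boundary value problem $$\Delta^2y(t-1)+\lambda y(t)=0,\quad t\in[1,T],\qquad y(0)=0,\quad y(T+1)=0.$$ Then $G(t,s)<0$ for all $t,s\in[1,T]$.
   Context: For integers $a\le b$, $[a,b]$ denotes the discrete interval $\{a,a+1,\dots,b\}$. $\Delta$ is the forward difference operator, $\Delta y(t)=y(t+1)-y(t)$, so $\Delta^2y(t-1)=y(t+1)-2y(t)+y(t-1)$. Write $Ly(t)=\Delta^2y(t-1)+\lambda y(t)$, $t\in[1,T]$. The number $\lambda_1$ is the first eigenvalue of the boundary value problem. The Cauchy function $y(t,s)$ for $Ly=0$ is, for each fixed $s\in[1,T]$, the solution $t\mapsto y(t,s)$ of $Ly=0$ with $y(s,s)=0$, $y(s+1,s)=1$. The Green's function is defined, for each fixed $s\in[1,T]$, by $G(t,s)=u(t,s)$ for $0\le t\le s$ and $G(t,s)=v(t,s)$ for $s\le t\le T+1$. Here $u(\cdot,s)$ is the solution of $Lu=0$ on $[1,T]$ with $u(0,s)=0$ and $u(T+1,s)=-y(T+1,s)$, and $v(t,s)=u(t,s)+y(t,s)$. *)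

theory Defs
  imports Complex_Main "HOL-Library.FuncSet"
begin

definition fwd_diff :: "(int \<Rightarrow> real) \<Rightarrow> int \<Rightarrow> real" where
  "fwd_diff y t = y (t + 1) - y t"

definition Lop :: "real \<Rightarrow> (int \<Rightarrow> real) \<Rightarrow> int \<Rightarrow> real" where
  "Lop lam y t = fwd_diff (fwd_diff y) (t - 1) + lam * y t"

text \<open>
  The equation on \<open>[1, T]\<close> involves \<open>y\<close> exactly on \<open>[0, T + 1]\<close>.
  Functions on that interval are elements of \<^const>\<open>extensional\<close>, which pins the
  irrelevant values outside it and so makes the definite descriptions below meaningful.
\<close>

definition is_solution :: "int \<Rightarrow> real \<Rightarrow> (int \<Rightarrow> real) \<Rightarrow> bool" where
  "is_solution T lam y \<longleftrightarrow>
     y \<in> extensional {0..T + 1} \<and> (\<forall>t\<in>{1..T}. Lop lam y t = 0)"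

definition cauchy_fun :: "int \<Rightarrow> real \<Rightarrow> int \<Rightarrow> int \<Rightarrow> real" where
  "cauchy_fun T lam t s =
     (THE y. is_solution T lam y \<and> y s = 0 \<and> y (s + 1) = 1) t"

definition green_u :: "int \<Rightarrow> real \<Rightarrow> int \<Rightarrow> int \<Rightarrow> real" where
  "green_u T lam t s =
     (THE u. is_solution T lam u \<and> u 0 = 0 \<and> u (T + 1) = - cauchy_fun T lam (T + 1) s) t"

definition green_v :: "int \<Rightarrow> real \<Rightarrow> int \<Rightarrow> int \<Rightarrow> real" where
  "green_v T lam t s = green_u T lam t s + cauchy_fun T lam t s"

text \<open>
  Both branches apply at \<open>t = s\<close>; they agree there because the Cauchy function
  vanishes on the diagonal.
\<close>

definition green_fun :: "int \<Rightarrow> real \<Rightarrow> int \<Rightarrow> int \<Rightarrow> real" where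
  "green_fun T lam t s = (if t \<le> s then green_u T lam t s else green_v T lam t s)"

end

theory Submission
  imports Defs
begin

text \<open>
  Let \<open>p\<close> be the solution on all of \<open>\<int>\<close> with \<open>p 0 = 0\<close> and \<open>p 1 = 1\<close>. Comparing \<open>p\<close> with the
  eigenfunction \<open>sin (\<pi> t / (T + 1))\<close> through their Casoratian shows that \<open>p > 0\<close> on \<open>[1, T + 1]\<close>
  when \<open>\<lambda> < \<lambda>\<^sub>1\<close>. The Cauchy function is \<open>p (t - s)\<close>, so the Green's function equals
  \<open>- p t * p (T + 1 - s) / p (T + 1)\<close> for \<open>t \<le> s\<close> and \<open>- p s * p (T + 1 - t) / p (T + 1)\<close> for
  \<open>t \<ge> s\<close>.
\<close>

lemma Lop_eq_0_iff: "Lop lam y t = 0 \<longleftrightarrow> y (t + 1) = (2 - lam) * y t - y (t - 1)"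
  by (auto simp: Lop_def fwd_diff_def algebra_simps)

lemma is_solution_iff:
  "is_solution T lam y \<longleftrightarrow> y \<in> extensional {0..T + 1} \<and>
     (\<forall>t\<in>{1..T}. y (t + 1) = (2 - lam) * y t - y (t - 1))"
  by (simp add: is_solution_def Lop_eq_0_iff)

fun fund_nat :: "real \<Rightarrow> nat \<Rightarrow> real" where
  "fund_nat lam 0 = 0"
| "fund_nat lam (Suc 0) = 1"
| "fund_nat lam (Suc (Suc n)) = (2 - lam) * fund_nat lam (Suc n) - fund_nat lam n"

text \<open>The odd extension satisfies the recurrence on all of \<open>\<int>\<close>.\<close>

definition fund :: "real \<Rightarrow> int \<Rightarrow> real" where
  "fund lam t = (if 0 \<le> t then fund_nat lam (nat t) else - fund_nat lam (nat (- t)))"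

lemma fund_0 [simp]: "fund lam 0 = 0"
  and fund_1 [simp]: "fund lam 1 = 1"
  by (simp_all add: fund_def)

lemma fund_minus: "fund lam (- t) = - fund lam t"
  by (auto simp: fund_def)

lemma fund_step_nonneg:
  assumes "0 \<le> t"
  shows "fund lam (t + 1) = (2 - lam) * fund lam t - fund lam (t - 1)"
proof (cases "t = 0")
  case True
  \<comment> \<open>Oddness supplies \<open>fund lam (- 1) = - 1\<close>, which is what the
    recurrence at 0 demands.\<close>
  then show ?thesis by (simp add: fund_minus[of lam 1])
next
  case False
  define n where "n = nat (t - 1)"
  have "nat (t - 1) = n" "nat t = Suc n" "nat (t + 1) = Suc (Suc n)"
    using assms False by (auto simp: n_def)
  then show ?thesis
    using assms False by (simp add: fund_def)
qed

lemma fund_step: "fund lam (t + 1) = (2 - lam) * fund lam t - fund lam (t - 1)"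
proof (cases "0 \<le> t")
  case True
  then show ?thesis by (rule fund_step_nonneg)
next
  case False
  then have "fund lam (- t + 1) = (2 - lam) * fund lam (- t) - fund lam (- t - 1)"
    by (intro fund_step_nonneg) simp
  moreover have "fund lam (- t + 1) = - fund lam (t - 1)" "fund lam (- t - 1) = - fund lam (t + 1)"
    by (simp_all flip: fund_minus)
  ultimately show ?thesis
    by (simp add: fund_minus algebra_simps)
qed

text \<open>The recurrence is reversible, as \<open>d (t - 1)\<close> enters with coefficient -1, so
  two adjacent zeros spread upwards and downwards. This gives the uniqueness behind the definite
  descriptions.\<close>

lemma recurrence_zero:
  fixes d :: "int \<Rightarrow> real"
  assumes rec: "\<And>t. t \<in> {1..T} \<Longrightarrow> d (t + 1) = c * d t - d (t - 1)"
    and s: "0 \<le> s" "s \<le> T" "d s = 0" "d (s + 1) = 0"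
    and t: "t \<in> {0..T + 1}"
  shows "d t = 0"
proof (cases "s \<le> t")
  case True
  have up: "k \<le> T \<longrightarrow> d k = 0 \<and> d (k + 1) = 0" if "s \<le> k" for k
    using that
  proof (induction k rule: int_ge_induct)
    case base
    then show ?case using s by simp
  next
    case (step i)
    then show ?case using s rec[of "i + 1"] by auto
  qed
  \<comment> \<open>The pairs of zeros stop at \<open>k = T\<close>, so the endpoint
    \<open>T + 1\<close> is read off as the second member of the last pair.\<close>
  show ?thesis using up[OF True] up[OF s(2)] t by (cases "t = T + 1") auto
next
  case False
  then have "t \<le> s" by simp
  then have "0 \<le> t \<longrightarrow> d t = 0 \<and> d (t + 1) = 0"
  proof (induction t rule: int_le_induct)
    case base
    then show ?case using s by simp
  next
    case (step i)
    then show ?case using s rec[of i] by auto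
  qed
  then show ?thesis using t by simp
qed

text \<open>Both sides agree at 0 and 1, so \<open>recurrence_zero\<close> kills their difference.
  Solutions vanishing at 0 thus form the line spanned by \<open>fund lam\<close>.\<close>

lemma recurrence_eq_fund:
  assumes "\<And>t. t \<in> {1..T} \<Longrightarrow> y (t + 1) = (2 - lam) * y t - y (t - 1)"
    and "0 \<le> T" "y 0 = 0" "t \<in> {0..T + 1}"
  shows "y t = y 1 * fund lam t"
proof -
  have "(\<lambda>t. y t - y 1 * fund lam t) t = 0"
    by (rule recurrence_zero[where T = T and c = "2 - lam" and s = 0])
      (use assms in \<open>auto simp: fund_step[of lam] algebra_simps\<close>)
  then show ?thesis by simp
qed

lemma fund_pos:
  assumes "T \<ge> 1" and lam: "lam < 2 - 2 * cos (pi / (real_of_int T + 1))"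
    and t: "t \<in> {1..T + 1}"
  shows "0 < fund lam t"
proof -
  define \<theta> where "\<theta> = pi / (real_of_int T + 1)"
  define w where "w k = sin (real_of_int k * \<theta>)" for k :: int
  have T: "real_of_int T + 1 > 0" using assms by simp
  have w_step: "w (k + 1) = 2 * cos \<theta> * w k - w (k - 1)" for k
    by (simp add: w_def distrib_right left_diff_distrib sin_add sin_diff)
  have w_pos: "0 < w k" if "k \<in> {1..T}" for k
  proof -
    have "real_of_int k * \<theta> < pi"
      using that T by (simp add: \<theta>_def divide_less_eq)
    then show ?thesis
      unfolding w_def using that T by (intro sin_gt_zero) (auto simp: \<theta>_def)
  qed
  have w_last: "w (T + 1) = 0"
    using T by (simp add: w_def \<theta>_def)
  define C where "C k = fund lam (k + 1) * w k - fund lam k * w (k + 1)" for k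
  have C_step: "C k = C (k - 1) + (2 - 2 * cos \<theta> - lam) * fund lam k * w k" for k
    unfolding C_def w_step[of k] fund_step[of lam k] by (simp add: algebra_simps)
  have "1 \<le> t" using t by simp
  \<comment> \<open>The sign of \<open>C\<close> must be carried along: positive values at
    \<open>i\<close> push \<open>C\<close> strictly above 0, and \<open>C i > 0\<close> forces the
    next value of \<open>fund lam\<close> to be positive.\<close>
  then have "t \<le> T + 1 \<longrightarrow> 0 < fund lam t \<and> 0 \<le> C (t - 1)"
  proof (induction t rule: int_ge_induct)
    case base
    then show ?case by (simp add: C_def w_def)
  next
    case (step i)
    show ?case
    proof
      assume i: "i + 1 \<le> T + 1"
      with step have pos: "0 < fund lam i" "0 \<le> C (i - 1)" "0 < w i"
        by (auto intro: w_pos)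
      with lam have C: "0 < C i"
        unfolding C_step[of i] by (intro add_nonneg_pos mult_pos_pos) (auto simp: \<theta>_def)
      \<comment> \<open>Only a weak inequality is available, since \<open>w\<close> vanishes at
        \<open>T + 1\<close>; strictness comes from \<open>C i\<close>.\<close>
      have "0 \<le> w (i + 1)"
        using w_pos[of "i + 1"] w_last i step by (cases "i = T") auto
      with pos have "0 \<le> fund lam i * w (i + 1)" by simp
      with C have "0 < fund lam (i + 1) * w i" by (simp add: C_def)
      with pos C show "0 < fund lam (i + 1) \<and> 0 \<le> C (i + 1 - 1)"
        by (simp add: zero_less_mult_iff)
    qed
  qed
  then show ?thesis using t by simp
qed

lemma fund_shift_step:
  "fund lam (t + 1 - s) = (2 - lam) * fund lam (t - s) - fund lam (t - 1 - s)"
  using fund_step[of lam "t - s"] by (simp add: algebra_simps)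

lemma is_solution_restrict_fund:
  "is_solution T lam (restrict (\<lambda>t. c * fund lam (t - s)) {0..T + 1})"
  by (simp add: is_solution_iff fund_shift_step[of lam _ s] right_diff_distrib)

text \<open>The coefficients are constant, so translating \<open>fund lam\<close> by
  \<open>s\<close> gives a solution with the required values at \<open>s\<close> and
  \<open>s + 1\<close>.\<close>

lemma cauchy_fun_eq:
  assumes "s \<in> {1..T}" "t \<in> {0..T + 1}"
  shows "cauchy_fun T lam t s = fund lam (t - s)"
proof -
  have "(THE y. is_solution T lam y \<and> y s = 0 \<and> y (s + 1) = 1)
      = restrict (\<lambda>t. fund lam (t - s)) {0..T + 1}" (is "_ = ?z")
  proof (rule the_equality)
    show "is_solution T lam ?z \<and> ?z s = 0 \<and> ?z (s + 1) = 1"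
      using assms is_solution_restrict_fund[of T lam 1 s] by auto
    fix y assume y: "is_solution T lam y \<and> y s = 0 \<and> y (s + 1) = 1"
    show "y = ?z"
    proof (rule extensionalityI[where A = "{0..T + 1}"])
      fix t assume t: "t \<in> {0..T + 1}"
      have "(\<lambda>t. y t - fund lam (t - s)) t = 0"
        by (rule recurrence_zero[where T = T and c = "2 - lam" and s = s])
          (use y t assms in \<open>auto simp: is_solution_iff fund_shift_step[of lam _ s] right_diff_distrib\<close>)
      with t show "y t = ?z t" by simp
    qed (use y in \<open>auto simp: is_solution_def\<close>)
  qed
  then show ?thesis using assms by (simp add: cauchy_fun_def)
qed

text \<open>The condition at 0 leaves only multiples of \<open>fund lam\<close>; as
  \<open>fund lam (T + 1)\<close> is nonzero, the condition at \<open>T + 1\<close> fixes the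
  factor.\<close>

lemma green_u_eq:
  assumes "s \<in> {1..T}" "t \<in> {0..T + 1}" and nz: "fund lam (T + 1) \<noteq> 0"
  shows "green_u T lam t s = - fund lam (T + 1 - s) / fund lam (T + 1) * fund lam t"
proof -
  have T: "T \<ge> 1" using assms by simp
  have c: "cauchy_fun T lam (T + 1) s = fund lam (T + 1 - s)"
    using assms by (intro cauchy_fun_eq) auto
  define a where "a = - fund lam (T + 1 - s) / fund lam (T + 1)"
  have "(THE u. is_solution T lam u \<and> u 0 = 0 \<and> u (T + 1) = - fund lam (T + 1 - s))
      = restrict (\<lambda>t. a * fund lam t) {0..T + 1}" (is "_ = ?z")
  proof (rule the_equality)
    show "is_solution T lam ?z \<and> ?z 0 = 0 \<and> ?z (T + 1) = - fund lam (T + 1 - s)"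
      using T nz is_solution_restrict_fund[of T lam a 0] by (simp add: a_def)
    fix u assume u: "is_solution T lam u \<and> u 0 = 0 \<and> u (T + 1) = - fund lam (T + 1 - s)"
    have *: "u t = u 1 * fund lam t" if "t \<in> {0..T + 1}" for t
      by (rule recurrence_eq_fund[where T = T]) (use u T that in \<open>auto simp: is_solution_iff\<close>)
    have "u 1 = a"
      using *[of "T + 1"] u nz T by (simp add: a_def field_simps)
    with * u show "u = ?z"
      by (intro extensionalityI[where A = "{0..T + 1}"]) (auto simp: is_solution_def)
  qed
  then show ?thesis using assms by (simp add: green_u_def c a_def)
qed

text \<open>As functions of \<open>t\<close>, both sides solve the recurrence and agree at 0 and
  \<open>T + 1\<close>; the boundary value problem has only the zero solution when
  \<open>fund lam (T + 1)\<close> is nonzero.\<close>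

lemma fund_identity:
  assumes "T \<ge> 0" and nz: "fund lam (T + 1) \<noteq> 0" and t: "t \<in> {0..T + 1}"
  shows "fund lam (t - s) * fund lam (T + 1)
       = fund lam (T + 1 - s) * fund lam t - fund lam s * fund lam (T + 1 - t)"
proof -
  define f where "f t = fund lam (t - s) * fund lam (T + 1) - fund lam (T + 1 - s) * fund lam t
    + fund lam s * fund lam (T + 1 - t)" for t
  have step: "f (t + 1) = (2 - lam) * f t - f (t - 1)" for t
  proof -
    \<comment> \<open>The recurrence is symmetric under the reflection of \<open>t\<close> to
      \<open>T + 1 - t\<close>.\<close>
    have "fund lam (T + 1 - (t + 1))
        = (2 - lam) * fund lam (T + 1 - t) - fund lam (T + 1 - (t - 1))"
      using fund_step[of lam "T + 1 - t"] by (simp add: algebra_simps)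
    then show ?thesis
      unfolding f_def fund_step[of lam t] fund_shift_step[of lam t s] by (simp only:) (simp add: algebra_simps)
  qed
  have "f 0 = 0" by (simp add: f_def fund_minus)
  then have f: "f t = f 1 * fund lam t" if "t \<in> {0..T + 1}" for t
    by (intro recurrence_eq_fund[where T = T]) (use step assms that in auto)
  have "f (T + 1) = 0" by (simp add: f_def)
  with f[of "T + 1"] nz assms have "f 1 = 0" by simp
  with f[OF t] show ?thesis by (simp add: f_def)
qed

theorem mainTheorem5:
  fixes T :: int and lam lam1 :: real
  assumes "T \<ge> 1"
    and "lam1 = 2 - 2 * cos (pi / (real_of_int T + 1))"
    and "lam < lam1"
  shows "\<forall>t\<in>{1..T}. \<forall>s\<in>{1..T}. green_fun T lam t s < 0"
proof (intro ballI)
  fix t s assume t: "t \<in> {1..T}" and s: "s \<in> {1..T}"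
  have pos: "0 < fund lam k" if "k \<in> {1..T + 1}" for k
    using fund_pos assms that by simp
  have pT: "0 < fund lam (T + 1)" using assms(1) by (intro pos) simp
  have u: "green_u T lam t s = - fund lam (T + 1 - s) / fund lam (T + 1) * fund lam t"
    using s t pT by (intro green_u_eq) auto
  show "green_fun T lam t s < 0"
  proof (cases "t \<le> s")
    case True
    have "0 < fund lam (T + 1 - s) / fund lam (T + 1) * fund lam t"
      using s t pT by (intro mult_pos_pos divide_pos_pos pos) auto
    with True u show ?thesis by (simp add: green_fun_def)
  next
    case False
    \<comment> \<open>For \<open>t > s\<close> the value is a sum of terms of opposite sign; the
      identity collapses it to a single negative product.\<close>
    have "fund lam (t - s) * fund lam (T + 1)
       = fund lam (T + 1 - s) * fund lam t - fund lam s * fund lam (T + 1 - t)"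
      using t assms(1) pT by (intro fund_identity) auto
    moreover have "cauchy_fun T lam t s = fund lam (t - s)"
      using s t by (intro cauchy_fun_eq) auto
    ultimately have "green_v T lam t s = - (fund lam s * fund lam (T + 1 - t) / fund lam (T + 1))"
      using u pT by (simp add: green_v_def field_simps)
    moreover have "0 < fund lam s * fund lam (T + 1 - t) / fund lam (T + 1)"
      using s t pT by (intro mult_pos_pos divide_pos_pos pos) auto
    ultimately show ?thesis using False by (simp add: green_fun_def)
  qed
qed

end
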